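(* Let $X$ be a compact topological space and $f_{1,\infty}=\{f_i\}_{i=1}^\infty$ a sequence of continuous self-maps of $X$. Then for any nonempty $Z\subseteq X$ and all $0<\theta<\phi\le 1$, \[ \overline{h}_{\mathrm{top}}(f_{1,\infty},Z,\theta)\le \overline{h}_{\mathrm{top}}(f_{1,\infty},Z,\phi)\le \frac{\phi}{\theta}\,\overline{h}_{\mathrm{top}}(f_{1,\infty},Z,\theta), \] and likewise \[ \underline{h}_{\mathrm{top}}(f_{1,\infty},Z,\theta)\le \underline{h}_{\mathrm{top}}(f_{1,\infty},Z,\phi)\le \frac{\phi}{\theta}\,\underline{h}_{\mathrm{top}}(f_{1,\infty},Z,\theta). \]
   Context: Intermediate topological entropies. Let $X$ be a compact topological space and $f_{1,\infty}=\{f_i\}_{i=1}^\infty$ a sequence of continuous maps $X\to X$. Put $f_i^0=\mathrm{id}_X$ and $f_i^j=f_{i+j-1}\circ\cdots\circ f_{i+1}\circ f_i$ for $j\ge1$. For a finite open cover $\mathcal U$ of $X$ and $m\in\mathbb N=\{1,2,\dots\}$, a string of length $m(\mathbf U)=m$ is an element $\mathbf U=(U_0,\dots,U_{m-1})\in\mathcal S_m(\mathcal U):=\mathcal U^m$, and $X(\mathbf U)=\{x\in X: f_1^j(x)\in U_j,\ 0\le j\le m-1\}$. For $Z\subseteq X$, $\alpha\ge0$, $\theta\in[0,1]$, $N\in\mathbb N$ let \[ M(Z,\alpha,\mathcal U,N,\theta)=\inf_{\mathcal G}\sum_{\mathbf U\in\mathcal G}e^{-\alpha m(\mathbf U)},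 \] the infimum over all finite or countable collections $\mathcal G\subseteq\bigcup_{N\le m<N/\theta+1}\mathcal S_m(\mathcal U)$ with $Z\subseteq\bigcup_{\mathbf U\in\mathcal G}X(\mathbf U)$ (for $\theta=0$, $N/\theta=+\infty$). Let $\underline m(Z,\alpha,\mathcal U,\theta)=\liminf_{N\to\infty}M(Z,\alpha,\mathcal U,N,\theta)$ and $\overline m(Z,\alpha,\mathcal U,\theta)=\limsup_{N\to\infty}M(Z,\alpha,\mathcal U,N,\theta)$. Set $\underline h_{\mathrm{top}}(f_{1,\infty},Z,\mathcal U,\theta)=\inf\{\alpha\ge0:\underline m(Z,\alpha,\mathcal U,\theta)=0\}$, $\overline h_{\mathrm{top}}(f_{1,\infty},Z,\mathcal U,\theta)=\inf\{\alpha\ge0:\overline m(Z,\alpha,\mathcal U,\theta)=0\}$. The lower and upper $\theta$-intermediate topological entropies $\underline h_{\mathrm{top}}(f_{1,\infty},Z,\theta)$ and $\overline h_{\mathrm{top}}(f_{1,\infty},Z,\theta)$, with values in $[0,\infty]$, are the suprema of these quantities over all finite open covers $\mathcal U$ of $X$. *)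

theory Defs
  imports "HOL-Analysis.Analysis"
begin

text \<open>
  A nonautonomous system is a sequence \<open>f :: nat \<Rightarrow> 'a \<Rightarrow> 'a\<close> of which only the members
  \<open>f i\<close> with \<open>i \<ge> 1\<close> matter: \<open>nds_iter f i j\<close> is the composition
  \<open>f (i + j - 1) \<circ> \<dots> \<circ> f (i + 1) \<circ> f i\<close> of \<open>j\<close> maps.
\<close>

primrec nds_iter :: "(nat \<Rightarrow> 'a \<Rightarrow> 'a) \<Rightarrow> nat \<Rightarrow> nat \<Rightarrow> 'a \<Rightarrow> 'a" where
  "nds_iter f i 0 = id"
| "nds_iter f i (Suc j) = f (i + j) \<circ> nds_iter f i j"

definition finite_open_cover :: "'a topology \<Rightarrow> 'a set set \<Rightarrow> bool" where
  "finite_open_cover X \<U> \<longleftrightarrow> finite \<U> \<and> (\<forall>U\<in>\<U>. openin X U) \<and> \<Union>\<U> = topspace X"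

definition strings :: "'a set set \<Rightarrow> nat \<Rightarrow> 'a set list set" where
  "strings \<U> m = {s. length s = m \<and> set s \<subseteq> \<U>}"

definition string_set :: "'a topology \<Rightarrow> (nat \<Rightarrow> 'a \<Rightarrow> 'a) \<Rightarrow> 'a set list \<Rightarrow> 'a set" where
  "string_set X f s = {x \<in> topspace X. \<forall>j<length s. nds_iter f 1 j x \<in> s ! j}"

text \<open>
  The disjunct \<open>\<theta> = 0\<close> encodes \<open>N / 0 = \<infinity>\<close>, as division by zero yields zero in HOL.
\<close>

definition admissible_lengths :: "nat \<Rightarrow> real \<Rightarrow> nat set" where
  "admissible_lengths N \<theta> = {m. N \<le> m \<and> (\<theta> = 0 \<or> real m < real N / \<theta> + 1)}"

definition string_covers ::
  "'a topology \<Rightarrow> (nat \<Rightarrow> 'a \<Rightarrow> 'a) \<Rightarrow> 'a set \<Rightarrow> 'a set set \<Rightarrow> nat \<Rightarrow> real \<Rightarrow> 'a set list set set"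
where
  "string_covers X f Z \<U> N \<theta> =
     {\<G>. countable \<G> \<and> \<G> \<subseteq> (\<Union>m\<in>admissible_lengths N \<theta>. strings \<U> m) \<and>
          Z \<subseteq> (\<Union>s\<in>\<G>. string_set X f s)}"

text \<open>
  The sums take values in \<open>ennreal\<close>, where every family is summable and a divergent series
  has the sum \<open>\<infinity>\<close>.
\<close>

definition cover_sum ::
  "'a topology \<Rightarrow> (nat \<Rightarrow> 'a \<Rightarrow> 'a) \<Rightarrow> 'a set \<Rightarrow> real \<Rightarrow> 'a set set \<Rightarrow> nat \<Rightarrow> real \<Rightarrow> ennreal"
where
  "cover_sum X f Z \<alpha> \<U> N \<theta> =
     (INF \<G>\<in>string_covers X f Z \<U> N \<theta>.
        \<Sum>\<^sub>\<infinity>s\<in>\<G>. ennreal (exp (- \<alpha> * real (length s))))"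

definition lower_m ::
  "'a topology \<Rightarrow> (nat \<Rightarrow> 'a \<Rightarrow> 'a) \<Rightarrow> 'a set \<Rightarrow> real \<Rightarrow> 'a set set \<Rightarrow> real \<Rightarrow> ennreal" where
  "lower_m X f Z \<alpha> \<U> \<theta> = liminf (\<lambda>N. cover_sum X f Z \<alpha> \<U> N \<theta>)"

definition upper_m ::
  "'a topology \<Rightarrow> (nat \<Rightarrow> 'a \<Rightarrow> 'a) \<Rightarrow> 'a set \<Rightarrow> real \<Rightarrow> 'a set set \<Rightarrow> real \<Rightarrow> ennreal" where
  "upper_m X f Z \<alpha> \<U> \<theta> = limsup (\<lambda>N. cover_sum X f Z \<alpha> \<U> N \<theta>)"

definition lower_entropy_cover ::
  "'a topology \<Rightarrow> (nat \<Rightarrow> 'a \<Rightarrow> 'a) \<Rightarrow> 'a set \<Rightarrow> 'a set set \<Rightarrow> real \<Rightarrow> ennreal" where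
  "lower_entropy_cover X f Z \<U> \<theta> = (INF \<alpha>\<in>{\<alpha>. \<alpha> \<ge> 0 \<and> lower_m X f Z \<alpha> \<U> \<theta> = 0}. ennreal \<alpha>)"

definition upper_entropy_cover ::
  "'a topology \<Rightarrow> (nat \<Rightarrow> 'a \<Rightarrow> 'a) \<Rightarrow> 'a set \<Rightarrow> 'a set set \<Rightarrow> real \<Rightarrow> ennreal" where
  "upper_entropy_cover X f Z \<U> \<theta> = (INF \<alpha>\<in>{\<alpha>. \<alpha> \<ge> 0 \<and> upper_m X f Z \<alpha> \<U> \<theta> = 0}. ennreal \<alpha>)"

definition lower_entropy ::
  "'a topology \<Rightarrow> (nat \<Rightarrow> 'a \<Rightarrow> 'a) \<Rightarrow> 'a set \<Rightarrow> real \<Rightarrow> ennreal" where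
  "lower_entropy X f Z \<theta> = (SUP \<U>\<in>{\<U>. finite_open_cover X \<U>}. lower_entropy_cover X f Z \<U> \<theta>)"

definition upper_entropy ::
  "'a topology \<Rightarrow> (nat \<Rightarrow> 'a \<Rightarrow> 'a) \<Rightarrow> 'a set \<Rightarrow> real \<Rightarrow> ennreal" where
  "upper_entropy X f Z \<theta> = (SUP \<U>\<in>{\<U>. finite_open_cover X \<U>}. upper_entropy_cover X f Z \<U> \<theta>)"

end

theory Submission
  imports Defs
begin

text \<open>
  Shrinking \<open>\<theta>\<close> admits more covers, which gives monotonicity. Conversely, truncate all strings of a
  cover admissible for \<open>\<theta>\<close> to length at most \<open>L = \<lceil>N / \<phi>\<rceil>\<close>, the greatest integer below
  \<open>N / \<phi> + 1\<close>: they still cover \<open>Z\<close> and are admissible for \<open>\<phi>\<close>. Since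
  \<open>(\<phi> / \<theta>) L \<ge> N / \<theta> > m - 1\<close> for every length \<open>m\<close> admissible for \<open>\<theta>\<close>, passing from \<open>\<alpha>\<close> to
  \<open>(\<phi> / \<theta>) \<alpha>\<close> increases the sum at most by the factor \<open>e\<^sup>\<alpha>\<close>, which does not depend on \<open>N\<close>.
\<close>

lemma infsum_cmult_ennreal:
  fixes c :: ennreal
  shows "(\<Sum>\<^sub>\<infinity>x\<in>A. c * g x) = c * (\<Sum>\<^sub>\<infinity>x\<in>A. g x)"
  by (simp add: nonneg_infsum_complete SUP_mult_left_ennreal sum_distrib_left)

lemma infsum_image_le_ennreal:
  fixes g :: "'b \<Rightarrow> ennreal"
  shows "(\<Sum>\<^sub>\<infinity>y\<in>h ` A. g y) \<le> (\<Sum>\<^sub>\<infinity>x\<in>A. g (h x))"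
proof -
  obtain B where B: "B \<subseteq> A" "inj_on h B" "h ` A = h ` B"
    using subset_image_inj[of "h ` A" h A] by auto
  have "infsum g (h ` A) = infsum (g \<circ> h) B"
    using B by (simp add: infsum_reindex)
  also have "\<dots> \<le> infsum (g \<circ> h) A"
    using B by (intro infsum_mono_neutral nonneg_summable_on_complete) auto
  finally show ?thesis by (simp add: comp_def)
qed

text \<open>Multiplication by such a \<open>c\<close> is an order automorphism of
  \<open>ennreal\<close>, with inverse the multiplication by \<open>inverse c\<close>; an empty
  \<open>I\<close> causes no exception, as both sides are then \<open>top\<close>.\<close>

lemma INF_mult_left_ennreal:
  fixes g :: "'b \<Rightarrow> ennreal"
  assumes "c \<noteq> 0" "c \<noteq> top"
  shows "c * (INF i\<in>I. g i) = (INF i\<in>I. c * g i)"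
proof (rule antisym)
  show "c * (INF i\<in>I. g i) \<le> (INF i\<in>I. c * g i)"
    by (intro INF_greatest mult_left_mono INF_lower) auto
  have "c * inverse c = 1"
    using assms by (simp add: ennreal_divide_self top.not_eq_extremum flip: divide_ennreal_def)
  then have inv: "inverse c * (c * x) = x" "c * (inverse c * x) = x" for x
    by (metis mult.assoc mult.commute mult_1)+
  have "inverse c * (INF i\<in>I. c * g i) \<le> (INF i\<in>I. g i)"
  proof (rule INF_greatest)
    fix i assume "i \<in> I"
    then have "inverse c * (INF i\<in>I. c * g i) \<le> inverse c * (c * g i)"
      by (intro mult_left_mono INF_lower) auto
    then show "inverse c * (INF i\<in>I. c * g i) \<le> g i" by (simp add: inv)
  qed
  then have "c * (inverse c * (INF i\<in>I. c * g i)) \<le> c * (INF i\<in>I. g i)"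
    by (rule mult_left_mono) simp
  then show "(INF i\<in>I. c * g i) \<le> c * (INF i\<in>I. g i)" by (simp add: inv)
qed

text \<open>A finite factor makes multiplication continuous and monotone on all of
  \<open>ennreal\<close>; for \<open>c = top\<close> continuity would fail at 0.\<close>

lemma
  fixes u :: "nat \<Rightarrow> ennreal"
  assumes "c < top"
  shows limsup_cmult_ennreal: "limsup (\<lambda>n. c * u n) = c * limsup u"
    and liminf_cmult_ennreal: "liminf (\<lambda>n. c * u n) = c * liminf u"
proof -
  have "continuous_on UNIV (\<lambda>x. c * x)"
    using assms by (auto simp: continuous_on_def intro!: ennreal_tendsto_cmult)
  moreover have "mono (\<lambda>x. c * x)"
    by (intro monoI mult_left_mono) auto
  ultimately show "limsup (\<lambda>n. c * u n) = c * limsup u" "liminf (\<lambda>n. c * u n) = c * liminf u"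
    by (auto intro: Limsup_compose_continuous_mono Liminf_compose_continuous_mono)
qed

text \<open>A shorter string imposes fewer conditions on the orbit, so truncated strings still cover
  \<open>Z\<close>.\<close>

lemma string_set_take: "string_set X f s \<subseteq> string_set X f (take n s)"
  by (auto simp: string_set_def)

lemma string_covers_antimono:
  assumes "0 < \<theta>" "\<theta> \<le> \<phi>"
  shows "string_covers X f Z \<U> N \<phi> \<subseteq> string_covers X f Z \<U> N \<theta>"
proof -
  have "real N / \<phi> \<le> real N / \<theta>"
    using assms by (intro divide_left_mono) auto
  then have "admissible_lengths N \<phi> \<subseteq> admissible_lengths N \<theta>"
    using assms by (auto simp: admissible_lengths_def)
  then show ?thesis by (fastforce simp: string_covers_def)
qed

lemma cover_sum_mono:
  assumes "0 < \<theta>" "\<theta> \<le> \<phi>"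
  shows "cover_sum X f Z \<alpha> \<U> N \<theta> \<le> cover_sum X f Z \<alpha> \<U> N \<phi>"
  unfolding cover_sum_def by (intro INF_superset_mono string_covers_antimono assms order_refl)

lemma cover_sum_scale_le:
  assumes "0 < \<theta>" "\<theta> \<le> \<phi>" "\<phi> \<le> 1" "0 \<le> \<alpha>"
  shows "cover_sum X f Z (\<phi> / \<theta> * \<alpha>) \<U> N \<phi> \<le> ennreal (exp \<alpha>) * cover_sum X f Z \<alpha> \<U> N \<theta>"
proof -
  define L where "L = nat \<lceil>real N / \<phi>\<rceil>"
  have L: "real N / \<phi> \<le> real L" "real L < real N / \<phi> + 1"
    using assms unfolding L_def by (simp_all add: of_nat_nat ceiling_correct) linarith+
  \<comment> \<open>Here \<phi> \<le> 1 enters: cutting at \<open>L\<close> leaves no string shorter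
    than \<open>N\<close>.\<close>
  have "real N \<le> real N / \<phi>"
    using assms by (simp add: field_simps mult_left_le_one_le)
  with L have NL: "N \<le> L" by linarith
  have "real N / \<theta> = \<phi> / \<theta> * (real N / \<phi>)" using assms by simp
  also have "\<dots> \<le> \<phi> / \<theta> * real L" using assms L by (intro mult_left_mono) auto
  finally have L\<theta>: "real N / \<theta> \<le> \<phi> / \<theta> * real L" .
  let ?w = "\<lambda>\<alpha> s. ennreal (exp (- \<alpha> * real (length s)))"
  have main: "cover_sum X f Z (\<phi> / \<theta> * \<alpha>) \<U> N \<phi> \<le> ennreal (exp \<alpha>) * (\<Sum>\<^sub>\<infinity>s\<in>\<G>. ?w \<alpha> s)"
    if \<G>: "\<G> \<in> string_covers X f Z \<U> N \<theta>" for \<G>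
  proof -
    have len: "N \<le> length s" "real (length s) < real N / \<theta> + 1" "set s \<subseteq> \<U>" if "s \<in> \<G>" for s
      using that \<G> assms by (auto simp: string_covers_def admissible_lengths_def strings_def)
    have "take L ` \<G> \<subseteq> (\<Union>m\<in>admissible_lengths N \<phi>. strings \<U> m)"
    proof (rule image_subsetI)
      fix s assume s: "s \<in> \<G>"
      have "length (take L s) \<in> admissible_lengths N \<phi>"
        using NL L len[OF s] by (auto simp: admissible_lengths_def min_def)
      moreover have "set (take L s) \<subseteq> \<U>"
        using len(3)[OF s] set_take_subset by fast
      ultimately show "take L s \<in> (\<Union>m\<in>admissible_lengths N \<phi>. strings \<U> m)"
        unfolding strings_def by blast
    qed
    moreover have "Z \<subseteq> (\<Union>s\<in>take L ` \<G>. string_set X f s)"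
      using \<G> string_set_take[of X f _ L] by (fastforce simp: string_covers_def)
    ultimately have "take L ` \<G> \<in> string_covers X f Z \<U> N \<phi>"
      using \<G> by (simp add: string_covers_def)
    then have "cover_sum X f Z (\<phi> / \<theta> * \<alpha>) \<U> N \<phi> \<le> (\<Sum>\<^sub>\<infinity>s\<in>take L ` \<G>. ?w (\<phi> / \<theta> * \<alpha>) s)"
      unfolding cover_sum_def by (rule INF_lower)
    also have "\<dots> \<le> (\<Sum>\<^sub>\<infinity>s\<in>\<G>. ?w (\<phi> / \<theta> * \<alpha>) (take L s))"
      by (rule infsum_image_le_ennreal)
    also have "\<dots> \<le> (\<Sum>\<^sub>\<infinity>s\<in>\<G>. ennreal (exp \<alpha>) * ?w \<alpha> s)"
    proof (rule infsum_mono)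
      fix s assume s: "s \<in> \<G>"
      \<comment> \<open>An uncut string keeps its length, and \<phi> / \<theta> \<ge> 1 suffices; a
        cut one has length exactly \<open>L\<close>, and the bound for \<open>L\<close>
        applies.\<close>
      have "real (length s) \<le> \<phi> / \<theta> * real (length s)"
        using mult_right_mono[of 1 "\<phi> / \<theta>" "real (length s)"] assms by simp
      then have "real (length s) - 1 \<le> \<phi> / \<theta> * real (length (take L s))"
        using len(2)[OF s] L\<theta> by (cases "length s \<le> L") auto
      \<comment> \<open>The 1 subtracted here, from the strict bound \<open>N / \<theta> + 1\<close>
        on lengths, becomes the factor \<open>exp \<alpha>\<close>.\<close>
      then have "\<alpha> * (real (length s) - 1) \<le> \<alpha> * (\<phi> / \<theta> * real (length (take L s)))"
        using assms by (intro mult_left_mono)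
      then have "- (\<phi> / \<theta> * \<alpha>) * real (length (take L s)) \<le> \<alpha> + - \<alpha> * real (length s)"
        by (simp add: algebra_simps)
      then show "?w (\<phi> / \<theta> * \<alpha>) (take L s) \<le> ennreal (exp \<alpha>) * ?w \<alpha> s"
        by (simp only: ennreal_mult[symmetric] exp_ge_zero exp_add[symmetric])
          (intro ennreal_leI, simp)
    qed (auto intro: nonneg_summable_on_complete)
    also have "\<dots> = ennreal (exp \<alpha>) * (\<Sum>\<^sub>\<infinity>s\<in>\<G>. ?w \<alpha> s)"
      by (rule infsum_cmult_ennreal)
    finally show ?thesis .
  qed
  \<comment> \<open>Since \<open>exp \<alpha>\<close> is positive and finite, it moves inside the
    infimum, and \<open>main\<close> bounds each member.\<close>
  have "ennreal (exp \<alpha>) * cover_sum X f Z \<alpha> \<U> N \<theta> =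
      (INF \<G>\<in>string_covers X f Z \<U> N \<theta>. ennreal (exp \<alpha>) * (\<Sum>\<^sub>\<infinity>s\<in>\<G>. ?w \<alpha> s))"
    unfolding cover_sum_def by (rule INF_mult_left_ennreal) (auto simp: ennreal_eq_0_iff)
  with main show ?thesis by (simp add: INF_greatest)
qed

text \<open>Scaling by \<open>c\<close> carries the exponents satisfying \<open>P\<close> into those
  satisfying \<open>Q\<close>. With \<open>P\<close> and \<open>Q\<close> the vanishing of
  \<open>upper_m\<close> or \<open>lower_m\<close> at \<theta> and \<phi>, this serves both
  entropies.\<close>

lemma INF_critical_scale_le:
  fixes P Q :: "real \<Rightarrow> bool"
  assumes "0 < c" and "\<And>\<alpha>. 0 \<le> \<alpha> \<Longrightarrow> P \<alpha> \<Longrightarrow> Q (c * \<alpha>)"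
  shows "(INF \<alpha>\<in>{\<alpha>. \<alpha> \<ge> 0 \<and> Q \<alpha>}. ennreal \<alpha>) \<le> ennreal c * (INF \<alpha>\<in>{\<alpha>. \<alpha> \<ge> 0 \<and> P \<alpha>}. ennreal \<alpha>)"
proof -
  have "(INF \<alpha>\<in>{\<alpha>. \<alpha> \<ge> 0 \<and> Q \<alpha>}. ennreal \<alpha>) \<le> (INF \<alpha>\<in>{\<alpha>. \<alpha> \<ge> 0 \<and> P \<alpha>}. ennreal c * ennreal \<alpha>)"
    using assms by (intro INF_greatest INF_lower2[of "c * _"]) (auto simp: ennreal_mult)
  also have "\<dots> = ennreal c * (INF \<alpha>\<in>{\<alpha>. \<alpha> \<ge> 0 \<and> P \<alpha>}. ennreal \<alpha>)"
    using assms by (intro INF_mult_left_ennreal[symmetric]) (auto simp: ennreal_eq_0_iff)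
  finally show ?thesis .
qed

text \<open>Vanishing at \<phi> forces vanishing at \<theta>, so the infimum over exponents runs
  over a larger set at \<theta>; the supremum over open covers preserves the inequality.\<close>

lemma
  assumes "0 < \<theta>" "\<theta> \<le> \<phi>"
  shows upper_entropy_mono: "upper_entropy X f Z \<theta> \<le> upper_entropy X f Z \<phi>"
    and lower_entropy_mono: "lower_entropy X f Z \<theta> \<le> lower_entropy X f Z \<phi>"
proof -
  have "upper_m X f Z \<alpha> \<U> \<theta> \<le> upper_m X f Z \<alpha> \<U> \<phi>"
    and "lower_m X f Z \<alpha> \<U> \<theta> \<le> lower_m X f Z \<alpha> \<U> \<phi>" for \<alpha> \<U>
    unfolding upper_m_def lower_m_def using assms
    by (intro Limsup_mono Liminf_mono always_eventually allI cover_sum_mono; simp)+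
  then have "upper_m X f Z \<alpha> \<U> \<phi> = 0 \<Longrightarrow> upper_m X f Z \<alpha> \<U> \<theta> = 0"
    and "lower_m X f Z \<alpha> \<U> \<phi> = 0 \<Longrightarrow> lower_m X f Z \<alpha> \<U> \<theta> = 0" for \<alpha> \<U>
    by (metis le_zero_eq)+
  then have "upper_entropy_cover X f Z \<U> \<theta> \<le> upper_entropy_cover X f Z \<U> \<phi>"
    and "lower_entropy_cover X f Z \<U> \<theta> \<le> lower_entropy_cover X f Z \<U> \<phi>" for \<U>
    unfolding upper_entropy_cover_def lower_entropy_cover_def
    by (intro INF_superset_mono; blast)+
  then show "upper_entropy X f Z \<theta> \<le> upper_entropy X f Z \<phi>"
    and "lower_entropy X f Z \<theta> \<le> lower_entropy X f Z \<phi>"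
    unfolding upper_entropy_def lower_entropy_def by (intro SUP_mono'; blast)+
qed

lemma
  assumes "0 < \<theta>" "\<theta> \<le> \<phi>" "\<phi> \<le> 1"
  shows upper_entropy_scale_le: "upper_entropy X f Z \<phi> \<le> ennreal (\<phi> / \<theta>) * upper_entropy X f Z \<theta>"
    and lower_entropy_scale_le: "lower_entropy X f Z \<phi> \<le> ennreal (\<phi> / \<theta>) * lower_entropy X f Z \<theta>"
proof -
  have "upper_m X f Z (\<phi> / \<theta> * \<alpha>) \<U> \<phi> \<le> ennreal (exp \<alpha>) * upper_m X f Z \<alpha> \<U> \<theta>"
    and "lower_m X f Z (\<phi> / \<theta> * \<alpha>) \<U> \<phi> \<le> ennreal (exp \<alpha>) * lower_m X f Z \<alpha> \<U> \<theta>"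
    if "0 \<le> \<alpha>" for \<alpha> \<U>
    \<comment> \<open>The factor \<open>exp \<alpha>\<close> is finite and independent of
      \<open>N\<close>, so it moves inside the limits and the comparison is made for each
      \<open>N\<close>.\<close>
    unfolding upper_m_def lower_m_def
      limsup_cmult_ennreal[OF ennreal_less_top, symmetric]
      liminf_cmult_ennreal[OF ennreal_less_top, symmetric]
    using assms that
    by (intro Limsup_mono Liminf_mono always_eventually allI cover_sum_scale_le; simp)+
  then have m0: "upper_m X f Z \<alpha> \<U> \<theta> = 0 \<Longrightarrow> upper_m X f Z (\<phi> / \<theta> * \<alpha>) \<U> \<phi> = 0"
    and "lower_m X f Z \<alpha> \<U> \<theta> = 0 \<Longrightarrow> lower_m X f Z (\<phi> / \<theta> * \<alpha>) \<U> \<phi> = 0"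
    if "0 \<le> \<alpha>" for \<alpha> \<U>
    using that by (metis le_zero_eq mult_zero_right)+
  then have "upper_entropy_cover X f Z \<U> \<phi> \<le> ennreal (\<phi> / \<theta>) * upper_entropy_cover X f Z \<U> \<theta>"
    and "lower_entropy_cover X f Z \<U> \<phi> \<le> ennreal (\<phi> / \<theta>) * lower_entropy_cover X f Z \<U> \<theta>" for \<U>
    unfolding upper_entropy_cover_def lower_entropy_cover_def
    using assms by (intro INF_critical_scale_le; simp)+
  then show "upper_entropy X f Z \<phi> \<le> ennreal (\<phi> / \<theta>) * upper_entropy X f Z \<theta>"
    and "lower_entropy X f Z \<phi> \<le> ennreal (\<phi> / \<theta>) * lower_entropy X f Z \<theta>"
    \<comment> \<open>With \<phi> / \<theta> moved inside the supremum, the comparison is made for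
      each open cover separately.\<close>
    unfolding upper_entropy_def lower_entropy_def SUP_mult_left_ennreal
    by (intro SUP_mono'; blast)+
qed

theorem proposition2p8:
  fixes X :: "'a topology"
    and f :: "nat \<Rightarrow> 'a \<Rightarrow> 'a"
    and Z :: "'a set"
    and \<theta> \<phi> :: real
  assumes "compact_space X"
    and "\<And>i. i \<ge> 1 \<Longrightarrow> continuous_map X X (f i)"
    and "Z \<subseteq> topspace X" and "Z \<noteq> {}"
    and "0 < \<theta>" and "\<theta> < \<phi>" and "\<phi> \<le> 1"
  shows "upper_entropy X f Z \<theta> \<le> upper_entropy X f Z \<phi> \<and>
         upper_entropy X f Z \<phi> \<le> ennreal (\<phi> / \<theta>) * upper_entropy X f Z \<theta> \<and>
         lower_entropy X f Z \<theta> \<le> lower_entropy X f Z \<phi> \<and>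
         lower_entropy X f Z \<phi> \<le> ennreal (\<phi> / \<theta>) * lower_entropy X f Z \<theta>"
  using assms by (simp add: upper_entropy_mono lower_entropy_mono
      upper_entropy_scale_le lower_entropy_scale_le)

end
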